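(* Let $\beta>0$ and suppose $\hat x$ is a global minimizer of the problem $$\min_{x\in\mathcal X}\ \mathcal F_\beta(x)=x^\top D x+\beta\|x\|_0 .$$ Let $\hat\sigma=\{i:\hat x[i]\ne 0\}$ be the support of $\hat x$, and define for all $i\in\{1,\dots,N\}$ $$\rho_i=\max_{\substack{s\in\{-1,1\}\\ j\in\{1,\dots,N\}\setminus\{i\}}}\left\|e_i+s\,\frac{|\mathfrak r[i]|+\gamma\sqrt{D_{ii}}}{|\mathfrak r[j]|-\gamma\sqrt{D_{jj}}}\,e_j\right\|_D,\qquad \eta=\min_{1\le i\le N}\left\{\frac{\bar{\mathfrak r}^2D_{ii}}{\left(|\mathfrak r[i]|-\gamma\sqrt{D_{ii}}\right)^2}\right\}.$$ Then for every $i\in\hat\sigma$, $$|\hat x[i]|\ge\min\left\{\frac{\sqrt{\eta+\beta}-\sqrt\eta}{\rho_i},\ \frac{\bar{\mathfrak r}}{|\mathfrak r[i]|-\gamma\sqrt{D_{ii}}}\right\}.$$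
   Context: Data: $N\ge 2$; $D\in\mathbb R^{N\times N}$ is a symmetric positive definite matrix with diagonal entries $D_{ii}$; $\hat r\in\mathbb R^N$; $r_c,\bar r\in\mathbb R$; $\gamma>0$. Set $\mathfrak r=\hat r-r_c\mathbf 1\in\mathbb R^N$ (with entries $\mathfrak r[i]$, where $\mathbf 1$ is the all-ones vector) and $\bar{\mathfrak r}=\bar r-r_c$. Notation: $\|x\|_D=\sqrt{x^\top D x}$; $\|x\|_0$ is the number of nonzero entries of $x$; $e_i$ is the $i$-th canonical basis vector of $\mathbb R^N$. The feasible set is $\mathcal X=\{x\in\mathbb R^N:\ \mathfrak r^\top x-\gamma\|x\|_D\ge\bar{\mathfrak r}\}$. Standing assumptions: (1) $\bar r>r_c$, i.e. $\bar{\mathfrak r}>0$; (2) $\min_{1\le i\le N}|\mathfrak r[i]|/\sqrt{D_{ii}}>\gamma$. *)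

theory Defs
  imports "HOL-Analysis.Analysis"
begin

definition sym_pos_def :: "real^'n^'n \<Rightarrow> bool" where
  "sym_pos_def D \<longleftrightarrow> transpose D = D \<and> (\<forall>x. x \<noteq> 0 \<longrightarrow> x \<bullet> (D *v x) > 0)"

definition norm_D :: "real^'n^'n \<Rightarrow> real^'n \<Rightarrow> real" where
  "norm_D D x = sqrt (x \<bullet> (D *v x))"

definition supp :: "real^'n \<Rightarrow> 'n set" where
  "supp x = {i. x $ i \<noteq> 0}"

definition l0_norm :: "real^'n \<Rightarrow> nat" where
  "l0_norm x = card (supp x)"

text \<open>Below, \<open>r\<close> and \<open>b\<close> are the shifted data \<open>rhat - rc 1\<close> and \<open>rbar - rc\<close>, not
  \<open>rhat\<close> and \<open>rbar\<close> themselves.\<close>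

definition feasible :: "real^'n^'n \<Rightarrow> real^'n \<Rightarrow> real \<Rightarrow> real \<Rightarrow> (real^'n) set" where
  "feasible D r \<gamma> b = {x. r \<bullet> x - \<gamma> * norm_D D x \<ge> b}"

definition objective :: "real^'n^'n \<Rightarrow> real \<Rightarrow> real^'n \<Rightarrow> real" where
  "objective D \<beta> x = x \<bullet> (D *v x) + \<beta> * real (l0_norm x)"

definition rho :: "real^'n^'n \<Rightarrow> real^'n \<Rightarrow> real \<Rightarrow> 'n \<Rightarrow> real" where
  "rho D r \<gamma> i =
     Max ((\<lambda>(s, j). norm_D D (axis i 1 +
            (s * ((\<bar>r $ i\<bar> + \<gamma> * sqrt (D $ i $ i)) / (\<bar>r $ j\<bar> - \<gamma> * sqrt (D $ j $ j))))
              *\<^sub>R axis j 1))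
          ` ({-1, 1} \<times> (UNIV - {i})))"

definition eta :: "real^'n^'n \<Rightarrow> real^'n \<Rightarrow> real \<Rightarrow> real \<Rightarrow> real" where
  "eta D r \<gamma> b = (MIN i. b\<^sup>2 * D $ i $ i / (\<bar>r $ i\<bar> - \<gamma> * sqrt (D $ i $ i))\<^sup>2)"

end

theory Submission
  imports Defs
begin

text \<open>Two comparisons with the minimizer \<open>x\<close> give the bound.

  A vector \<open>t e\<^sub>j\<close> with a single nonzero entry whose sign agrees with \<open>r\<^sub>j\<close> is feasible as soon as
  \<open>\<bar>t\<bar> (\<bar>r\<^sub>j\<bar> - \<gamma> \<surd>D\<^sub>j\<^sub>j) \<ge> b\<close>; the cheapest such vectors have objective \<open>\<eta> + \<beta>\<close>. If \<open>x\<close>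
  has any nonzero entry, then it also pays \<open>\<beta>\<close> at least once, which forces \<open>\<parallel>x\<parallel>\<^sub>D\<^sup>2 \<le> \<eta>\<close> (lemmas \<open>axis_multiple_feasible\<close> and
  \<open>minimizer_quadratic_le_eta\<close>).

  Fix \<open>i\<close> in the support. If it is the only element, feasibility of \<open>x = x\<^sub>i e\<^sub>i\<close> yields the
  second bound (lemma \<open>singleton_support_bound\<close>). Otherwise there is another index \<open>j\<close> in the support. Delete the entry \<open>x\<^sub>i\<close> and
  compensate for it by moving \<open>x\<^sub>j\<close> in the direction of the sign of \<open>r\<^sub>j\<close>: deleting costs at most
  \<open>\<bar>x\<^sub>i\<bar> (\<bar>r\<^sub>i\<bar> + \<gamma> \<surd>D\<^sub>i\<^sub>i)\<close> in the constraint, and each unit of \<open>j\<close> gains at least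
  \<open>\<bar>r\<^sub>j\<bar> - \<gamma> \<surd>D\<^sub>j\<^sub>j > 0\<close>. The quotient of these two is the factor in the definition of \<open>\<rho>\<^sub>i\<close>, so the
  new point \<open>y\<close> is feasible with \<open>\<parallel>y - x\<parallel>\<^sub>D \<le> \<rho>\<^sub>i \<bar>x\<^sub>i\<bar>\<close>, and its support has lost \<open>i\<close> (lemma
  \<open>exchange\<close>). Minimality now says that the saving \<open>\<beta>\<close> does not exceed the growth of the quadratic
  term: \<open>\<parallel>x\<parallel>\<^sub>D\<^sup>2 + \<beta> \<le> (\<parallel>x\<parallel>\<^sub>D + \<rho>\<^sub>i \<bar>x\<^sub>i\<bar>)\<^sup>2\<close>. As \<open>\<parallel>x\<parallel>\<^sub>D \<le> \<surd>\<eta>\<close>, solving for \<open>\<bar>x\<^sub>i\<bar>\<close> gives the first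
  bound.\<close>

section \<open>The norm of a positive definite matrix\<close>

lemma quadratic_nonneg:
  assumes "sym_pos_def D"
  shows "0 \<le> x \<bullet> (D *v x)"
  using assms unfolding sym_pos_def_def by (cases "x = 0") (auto intro: less_imp_le)

lemma norm_D_power2:
  assumes "sym_pos_def D"
  shows "(norm_D D x)\<^sup>2 = x \<bullet> (D *v x)"
  using quadratic_nonneg[OF assms] by (simp add: norm_D_def)

lemma norm_D_nonneg:
  assumes "sym_pos_def D"
  shows "0 \<le> norm_D D x"
  using quadratic_nonneg[OF assms] by (simp add: norm_D_def)

lemma inner_matrix_commute:
  assumes "sym_pos_def D"
  shows "x \<bullet> (D *v y) = y \<bullet> (D *v x)"
proof -
  have "x \<bullet> (D *v y) = (transpose D *v x) \<bullet> y"
    by (simp add: dot_lmul_matrix transpose_matrix_vector)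
  also have "transpose D = D" using assms by (simp add: sym_pos_def_def)
  finally show ?thesis by (simp add: inner_commute)
qed

lemma quadratic_add:
  assumes "sym_pos_def D"
  shows "(x + y) \<bullet> (D *v (x + y)) = x \<bullet> (D *v x) + 2 * (x \<bullet> (D *v y)) + y \<bullet> (D *v y)"
  using inner_matrix_commute[OF assms, of y x]
  by (simp add: matrix_vector_right_distrib inner_add_left inner_add_right)

lemma norm_D_scaleR: "norm_D D (c *\<^sub>R x) = \<bar>c\<bar> * norm_D D x"
  by (simp add: norm_D_def matrix_vector_mult_scaleR real_sqrt_mult flip: mult.assoc)

lemma norm_D_Cauchy_Schwarz:
  assumes D: "sym_pos_def D"
  shows "x \<bullet> (D *v y) \<le> norm_D D x * norm_D D y"
proof (cases "y = 0")
  case False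
  let ?q = "y \<bullet> (D *v y)" and ?m = "x \<bullet> (D *v y)"
  have q: "?q > 0" using D False by (simp add: sym_pos_def_def)
  \<comment> \<open>The minimizer of the quadratic polynomial \<open>t \<mapsto> \<parallel>x + t y\<parallel>\<^sub>D\<^sup>2\<close>.\<close>
  define t where "t = - (?m / ?q)"
  have "0 \<le> (x + t *\<^sub>R y) \<bullet> (D *v (x + t *\<^sub>R y))" by (rule quadratic_nonneg[OF D])
  also have "\<dots> = x \<bullet> (D *v x) - ?m\<^sup>2 / ?q"
    using q unfolding quadratic_add[OF D] matrix_vector_mult_scaleR inner_scaleR_left
      inner_scaleR_right
    by (simp add: t_def field_simps power2_eq_square)
  finally have "?m\<^sup>2 \<le> (norm_D D x * norm_D D y)\<^sup>2"
    using q by (simp add: power_mult_distrib norm_D_power2[OF D] field_simps)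
  then show ?thesis
    by (rule power2_le_imp_le) (simp add: norm_D_nonneg[OF D])
qed (simp add: norm_D_def)

lemma norm_D_triangle:
  assumes D: "sym_pos_def D"
  shows "norm_D D (x + y) \<le> norm_D D x + norm_D D y"
proof (rule power2_le_imp_le)
  show "(norm_D D (x + y))\<^sup>2 \<le> (norm_D D x + norm_D D y)\<^sup>2"
    using norm_D_Cauchy_Schwarz[OF D, of x y]
    by (simp add: norm_D_power2[OF D] quadratic_add[OF D] power2_sum)
qed (simp add: norm_D_nonneg[OF D])

lemma quadratic_axis: "axis i 1 \<bullet> (D *v axis i 1) = (D :: real^'n^'n) $ i $ i"
  by (simp add: inner_axis' matrix_vector_mult_basis column_def)

lemma diagonal_pos:
  assumes "sym_pos_def D"
  shows "D $ i $ i > 0"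
  using assms quadratic_axis[of i D] unfolding sym_pos_def_def by (metis axis_eq_0_iff zero_neq_one)

lemma norm_D_axis: "norm_D D (axis i 1) = sqrt (D $ i $ i)"
  by (simp add: norm_D_def quadratic_axis)

section \<open>Feasible points\<close>

text \<open>The bound on the minimal ratio says that every single coordinate, moved in the direction of the
  sign of its return, gains more in the linear part of the constraint than it loses in the norm.\<close>
lemma gain_pos:
  fixes D :: "real^'n^'n"
  assumes "sym_pos_def D" and "(MIN i. \<bar>r $ i\<bar> / sqrt (D $ i $ i)) > \<gamma>"
  shows "\<bar>r $ j\<bar> - \<gamma> * sqrt (D $ j $ j) > 0"
proof -
  have "\<gamma> < \<bar>r $ j\<bar> / sqrt (D $ j $ j)"
    using assms(2) by (subst (asm) Min_gr_iff) auto
  then show ?thesis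
    using diagonal_pos[OF assms(1), of j] by (simp add: field_simps)
qed

lemma gain_pos_imp_nonzero:
  assumes D: "sym_pos_def D" and "\<gamma> > 0" and gain: "\<bar>r $ j\<bar> - \<gamma> * sqrt (D $ j $ j) > 0"
  shows "r $ j \<noteq> 0"
proof
  assume "r $ j = 0"
  moreover have "\<gamma> * sqrt (D $ j $ j) > 0" using diagonal_pos[OF D, of j] \<open>\<gamma> > 0\<close> by simp
  ultimately show False using gain by simp
qed

lemma axis_multiple_feasible_iff:
  "t *\<^sub>R axis j 1 \<in> feasible D r \<gamma> b \<longleftrightarrow> t * r $ j - \<gamma> * (\<bar>t\<bar> * sqrt (D $ j $ j)) \<ge> b"
  by (simp add: feasible_def norm_D_scaleR norm_D_axis inner_axis)

lemma axis_multiple_feasible: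
  assumes D: "sym_pos_def D" and "\<gamma> > 0" and "b > 0"
    and gain: "\<bar>r $ j\<bar> - \<gamma> * sqrt (D $ j $ j) > 0"
  shows "(sgn (r $ j) * (b / (\<bar>r $ j\<bar> - \<gamma> * sqrt (D $ j $ j)))) *\<^sub>R axis j 1 \<in> feasible D r \<gamma> b"
proof -
  define a where "a = b / (\<bar>r $ j\<bar> - \<gamma> * sqrt (D $ j $ j))"
  have "r $ j \<noteq> 0" by (rule gain_pos_imp_nonzero[OF D \<open>\<gamma> > 0\<close> gain])
  moreover have "a > 0" using \<open>b > 0\<close> gain by (simp add: a_def)
  ultimately have t: "\<bar>sgn (r $ j) * a\<bar> = a" "sgn (r $ j) * a * r $ j = a * \<bar>r $ j\<bar>"
    by (auto simp: sgn_if)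
  have "a * (\<bar>r $ j\<bar> - \<gamma> * sqrt (D $ j $ j)) = b" using gain by (simp add: a_def)
  then have "(sgn (r $ j) * a) *\<^sub>R axis j 1 \<in> feasible D r \<gamma> b"
    unfolding axis_multiple_feasible_iff t by (simp add: algebra_simps)
  then show ?thesis unfolding a_def .
qed

section \<open>Exchanging two indices of the support\<close>

text \<open>Subtracting \<open>u e\<^sub>i\<close> lowers \<open>r \<bullet> x\<close> by at most \<open>\<bar>u\<bar> \<bar>r\<^sub>i\<bar>\<close>, whatever the sign of \<open>u\<close>, and adding
  \<open>c\<close> in the direction of the sign of \<open>r\<^sub>j\<close> raises it by exactly \<open>c \<bar>r\<^sub>j\<bar>\<close>. The triangle inequality
  bounds the growth of the \<open>D\<close>-norm by \<open>\<bar>u\<bar> \<surd>D\<^sub>i\<^sub>i + c \<surd>D\<^sub>j\<^sub>j\<close>; weighted with \<open>\<gamma>\<close>, this is what turns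
  the loss per unit into a sum and the gain per unit into a difference.\<close>
lemma exchange_feasible:
  assumes D: "sym_pos_def D" and "\<gamma> > 0" and "x \<in> feasible D r \<gamma> b"
    and "0 \<le> c"
    and comp: "\<bar>u\<bar> * (\<bar>r $ i\<bar> + \<gamma> * sqrt (D $ i $ i)) \<le> c * (\<bar>r $ j\<bar> - \<gamma> * sqrt (D $ j $ j))"
  shows "x - u *\<^sub>R axis i 1 + (sgn (r $ j) * c) *\<^sub>R axis j 1 \<in> feasible D r \<gamma> b"
proof -
  let ?y = "x + (- u) *\<^sub>R axis i 1 + (sgn (r $ j) * c) *\<^sub>R axis j 1"
  have "norm_D D ?y \<le> norm_D D x + norm_D D ((- u) *\<^sub>R axis i 1)
      + norm_D D ((sgn (r $ j) * c) *\<^sub>R axis j 1)"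
    by (meson D norm_D_triangle add_right_mono order_trans)
  also have "\<dots> \<le> norm_D D x + \<bar>u\<bar> * sqrt (D $ i $ i) + c * sqrt (D $ j $ j)"
    using \<open>0 \<le> c\<close> less_imp_le[OF diagonal_pos[OF D, of j]]
    unfolding norm_D_scaleR norm_D_axis
    by (simp add: abs_mult abs_sgn_eq)
  finally have "\<gamma> * norm_D D ?y \<le> \<gamma> * norm_D D x + \<gamma> * (\<bar>u\<bar> * sqrt (D $ i $ i) + c * sqrt (D $ j $ j))"
    using \<open>\<gamma> > 0\<close> by (simp flip: distrib_left add: add.assoc)
  moreover have "u * r $ i \<le> \<bar>u\<bar> * \<bar>r $ i\<bar>" by (metis abs_ge_self abs_mult)
  moreover have "r \<bullet> ?y = r \<bullet> x - u * r $ i + c * \<bar>r $ j\<bar>"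
    by (simp add: inner_add_right inner_diff_right inner_axis abs_sgn)
  ultimately have "r \<bullet> ?y - \<gamma> * norm_D D ?y \<ge> b"
    using comp \<open>x \<in> feasible D r \<gamma> b\<close> unfolding feasible_def by (simp add: algebra_simps)
  then show ?thesis by (simp add: feasible_def)
qed

text \<open>The sign \<open>s\<close> in the definition of \<open>rho\<close> ranges over both values because the relative sign of the
  deleted entry and the compensating step is arbitrary.\<close>
lemma exchange_norm_le_rho:
  assumes "i \<noteq> j" and "s \<in> {-1, 1 :: real}"
  shows "norm_D D (axis i 1 + (s * ((\<bar>r $ i\<bar> + \<gamma> * sqrt (D $ i $ i)) /
      (\<bar>r $ j\<bar> - \<gamma> * sqrt (D $ j $ j)))) *\<^sub>R axis j 1) \<le> rho D r \<gamma> i"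
  unfolding rho_def
proof (rule Max_ge)
  show "finite ((\<lambda>(s, j). norm_D D (axis i 1 +
            (s * ((\<bar>r $ i\<bar> + \<gamma> * sqrt (D $ i $ i)) / (\<bar>r $ j\<bar> - \<gamma> * sqrt (D $ j $ j))))
              *\<^sub>R axis j 1)) ` ({-1, 1} \<times> (UNIV - {i})))"
    by simp
qed (use assms in \<open>auto intro!: image_eqI[where x = "(s, j)"]\<close>)

lemma rho_pos:
  assumes D: "sym_pos_def D" and "i \<noteq> j"
  shows "rho D r \<gamma> i > 0"
proof -
  \<comment> \<open>The vector of the term \<open>s = 1\<close> of the maximum.\<close>
  let ?v = "axis i (1::real) + (1 * ((\<bar>r $ i\<bar> + \<gamma> * sqrt (D $ i $ i)) /
      (\<bar>r $ j\<bar> - \<gamma> * sqrt (D $ j $ j)))) *\<^sub>R axis j 1"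
  have "?v \<noteq> 0"
  proof
    assume "?v = 0"
    then have "?v $ i = 0 $ i" by (rule arg_cong)
    then show False using \<open>i \<noteq> j\<close> by (simp add: axis_def)
  qed
  then have "norm_D D ?v > 0" using D unfolding norm_D_def sym_pos_def_def real_sqrt_gt_0_iff by blast
  also have "\<dots> \<le> rho D r \<gamma> i" using \<open>i \<noteq> j\<close> by (intro exchange_norm_le_rho) auto
  finally show ?thesis .
qed

text \<open>The entry at \<open>j\<close> may vanish or stay, but since \<open>j\<close> was already in the support, the exchange
  never adds an index; this is where two indices of the support are needed.\<close>
lemma exchange:
  assumes D: "sym_pos_def D" and "\<gamma> > 0" and "x \<in> feasible D r \<gamma> b"
    and gain: "\<bar>r $ j\<bar> - \<gamma> * sqrt (D $ j $ j) > 0"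
    and supp: "i \<in> supp x" "j \<in> supp x" and "i \<noteq> j"
  obtains y where "y \<in> feasible D r \<gamma> b" and "supp y \<subseteq> supp x - {i}"
    and "norm_D D (y - x) \<le> rho D r \<gamma> i * \<bar>x $ i\<bar>"
proof -
  define q where "q = (\<bar>r $ i\<bar> + \<gamma> * sqrt (D $ i $ i)) / (\<bar>r $ j\<bar> - \<gamma> * sqrt (D $ j $ j))"
  define c where "c = \<bar>x $ i\<bar> * q"
  define y where "y = x - (x $ i) *\<^sub>R axis i 1 + (sgn (r $ j) * c) *\<^sub>R axis j 1"
  have "q \<ge> 0" using gain \<open>\<gamma> > 0\<close> diagonal_pos[OF D, of i] by (simp add: q_def)
  then have "c \<ge> 0" by (simp add: c_def)
  have "x $ i \<noteq> 0" using supp by (simp add: supp_def)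
  have "r $ j \<noteq> 0" by (rule gain_pos_imp_nonzero[OF D \<open>\<gamma> > 0\<close> gain])
  have "y \<in> feasible D r \<gamma> b"
    unfolding y_def using gain
    by (intro exchange_feasible assms \<open>c \<ge> 0\<close>) (simp add: c_def q_def)
  moreover have "supp y \<subseteq> supp x - {i}"
    using \<open>i \<noteq> j\<close> supp by (auto simp: supp_def y_def axis_def split: if_splits)
  moreover have "norm_D D (y - x) \<le> rho D r \<gamma> i * \<bar>x $ i\<bar>"
  proof -
    define s where "s = - (sgn (r $ j) * sgn (x $ i))"
    have s: "s \<in> {-1, 1}" using \<open>x $ i \<noteq> 0\<close> \<open>r $ j \<noteq> 0\<close> by (simp add: s_def sgn_if)
    have "y - x = (- (x $ i)) *\<^sub>R (axis i 1 + (s * q) *\<^sub>R axis j 1)"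
      by (simp add: y_def s_def c_def scaleR_diff_right abs_sgn mult_ac)
    then have "norm_D D (y - x) = \<bar>x $ i\<bar> * norm_D D (axis i 1 + (s * q) *\<^sub>R axis j 1)"
      by (simp add: norm_D_scaleR del: scaleR_minus_left)
    also have "\<dots> \<le> \<bar>x $ i\<bar> * rho D r \<gamma> i"
      unfolding q_def by (intro mult_left_mono exchange_norm_le_rho \<open>i \<noteq> j\<close> s) simp
    finally show ?thesis by (simp add: mult.commute)
  qed
  ultimately show thesis by (rule that)
qed

section \<open>Bounds for a minimizer\<close>

text \<open>Comparison with the points of \<open>axis_multiple_feasible\<close>, one for each index: their supports have at
  most one element and that of \<open>x\<close> has at least one, so the terms with \<open>\<beta>\<close> can be dropped from the comparison, and what remains is the
  quadratic form at the two points.\<close>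
lemma minimizer_quadratic_le_eta:
  fixes D :: "real^'n^'n"
  assumes D: "sym_pos_def D" and "\<gamma> > 0" and "b > 0" and "\<beta> > 0"
    and gain: "\<And>j. \<bar>r $ j\<bar> - \<gamma> * sqrt (D $ j $ j) > 0"
    and minimal: "\<And>y. y \<in> feasible D r \<gamma> b \<Longrightarrow> objective D \<beta> x \<le> objective D \<beta> y"
    and "supp x \<noteq> {}"
  shows "x \<bullet> (D *v x) \<le> eta D r \<gamma> b"
proof -
  have "x \<bullet> (D *v x) \<le> b\<^sup>2 * D $ j $ j / (\<bar>r $ j\<bar> - \<gamma> * sqrt (D $ j $ j))\<^sup>2" for j
  proof -
    define g where "g = \<bar>r $ j\<bar> - \<gamma> * sqrt (D $ j $ j)"
    define y :: "real^'n" where "y = (sgn (r $ j) * (b / g)) *\<^sub>R axis j 1"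
    have "y \<in> feasible D r \<gamma> b"
      unfolding y_def g_def by (rule axis_multiple_feasible[OF D \<open>\<gamma> > 0\<close> \<open>b > 0\<close> gain])
    then have le: "objective D \<beta> x \<le> objective D \<beta> y" by (rule minimal)
    have "card (supp y) \<le> card {j}"
      by (rule card_mono) (auto simp: supp_def y_def axis_def)
    moreover have "card (supp x) \<ge> 1" using \<open>supp x \<noteq> {}\<close> by (simp add: Suc_leI card_gt_0_iff)
    ultimately have "card (supp y) \<le> card (supp x)" by simp
    then have "\<beta> * real (card (supp y)) \<le> \<beta> * real (card (supp x))"
      using \<open>\<beta> > 0\<close> by simp
    then have "x \<bullet> (D *v x) \<le> y \<bullet> (D *v y)"
      using le unfolding objective_def l0_norm_def by linarith
    also have "\<dots> = (sgn (r $ j))\<^sup>2 * (b\<^sup>2 * D $ j $ j / g\<^sup>2)"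
      by (simp add: y_def matrix_vector_mult_scaleR quadratic_axis power2_eq_square)
    also have "\<dots> \<le> b\<^sup>2 * D $ j $ j / g\<^sup>2"
      using diagonal_pos[OF D, of j] by (simp add: sgn_if)
    finally show ?thesis by (simp add: g_def)
  qed
  then show ?thesis unfolding eta_def by (subst Min_ge_iff) auto
qed

text \<open>With only \<open>i\<close> in the support, the left-hand side of the constraint is at most
  \<open>\<bar>x\<^sub>i\<bar> (\<bar>r\<^sub>i\<bar> - \<gamma> \<surd>D\<^sub>i\<^sub>i)\<close>, with equality if \<open>x\<^sub>i\<close> and \<open>r\<^sub>i\<close> have the same sign.\<close>
lemma singleton_support_bound:
  assumes "x \<in> feasible D r \<gamma> b" and "supp x = {i}"
    and gain: "\<bar>r $ i\<bar> - \<gamma> * sqrt (D $ i $ i) > 0"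
  shows "b / (\<bar>r $ i\<bar> - \<gamma> * sqrt (D $ i $ i)) \<le> \<bar>x $ i\<bar>"
proof -
  have "x = (x $ i) *\<^sub>R axis i 1"
    using \<open>supp x = {i}\<close> by (auto simp: vec_eq_iff axis_def supp_def)
  then have "(x $ i) *\<^sub>R axis i 1 \<in> feasible D r \<gamma> b" using assms(1) by simp
  moreover have "x $ i * r $ i \<le> \<bar>x $ i\<bar> * \<bar>r $ i\<bar>" by (metis abs_ge_self abs_mult)
  ultimately have "b \<le> \<bar>x $ i\<bar> * (\<bar>r $ i\<bar> - \<gamma> * sqrt (D $ i $ i))"
    unfolding axis_multiple_feasible_iff by (simp add: algebra_simps)
  then show ?thesis using gain by (simp add: divide_le_eq)
qed

text \<open>Expanding the square turns the hypothesis into \<open>\<beta> \<le> 2 p d + d\<^sup>2\<close>, which is monotone in \<open>p\<close>, so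
  \<open>p\<close> may be replaced by its upper bound \<open>\<surd>h\<close>.\<close>
lemma sqrt_add_diff_le:
  fixes p d h \<beta> :: real
  assumes "0 \<le> p" "0 \<le> d" "p\<^sup>2 \<le> h" "p\<^sup>2 + \<beta> \<le> (p + d)\<^sup>2"
  shows "sqrt (h + \<beta>) - sqrt h \<le> d"
proof -
  have "0 \<le> h" using assms(3) by (smt (verit) zero_le_power2)
  have "p \<le> sqrt h" using assms(3) by (rule real_le_rsqrt)
  then have "p * d \<le> sqrt h * d" using \<open>0 \<le> d\<close> by (rule mult_right_mono)
  then have "h + \<beta> \<le> (sqrt h + d)\<^sup>2"
    using assms(4) \<open>0 \<le> h\<close> by (simp add: power2_sum)
  then have "sqrt (h + \<beta>) \<le> sqrt h + d"
    using \<open>0 \<le> h\<close> \<open>0 \<le> d\<close> by (intro real_le_lsqrt) auto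
  then show ?thesis by simp
qed

theorem theorem1:
  fixes D :: "real^'n^'n"
    and rhat r xhat :: "real^'n"
    and rc rbar b \<gamma> \<beta> :: real
  assumes "CARD('n) \<ge> 2"
    and "sym_pos_def D"
    and "\<gamma> > 0"
    and "r = rhat - rc *\<^sub>R 1"
    and "b = rbar - rc"
    and "rbar > rc"
    and "(MIN i. \<bar>r $ i\<bar> / sqrt (D $ i $ i)) > \<gamma>"
    and "\<beta> > 0"
    and "is_arg_min (objective D \<beta>) (\<lambda>x. x \<in> feasible D r \<gamma> b) xhat"
  shows "\<forall>i \<in> supp xhat.
    \<bar>xhat $ i\<bar> \<ge> min ((sqrt (eta D r \<gamma> b + \<beta>) - sqrt (eta D r \<gamma> b)) / rho D r \<gamma> i)
                    (b / (\<bar>r $ i\<bar> - \<gamma> * sqrt (D $ i $ i)))"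
proof
  fix i assume i: "i \<in> supp xhat"
  note D = \<open>sym_pos_def D\<close> and gamma = \<open>\<gamma> > 0\<close>
  note gain = gain_pos[OF D \<open>(MIN i. \<bar>r $ i\<bar> / sqrt (D $ i $ i)) > \<gamma>\<close>]
  have "b > 0" using \<open>b = rbar - rc\<close> \<open>rbar > rc\<close> by simp
  have feas: "xhat \<in> feasible D r \<gamma> b"
    and minimal: "\<And>y. y \<in> feasible D r \<gamma> b \<Longrightarrow> objective D \<beta> xhat \<le> objective D \<beta> y"
    using \<open>is_arg_min _ _ xhat\<close> by (auto simp: is_arg_min_def not_less)
  show "min ((sqrt (eta D r \<gamma> b + \<beta>) - sqrt (eta D r \<gamma> b)) / rho D r \<gamma> i)
          (b / (\<bar>r $ i\<bar> - \<gamma> * sqrt (D $ i $ i))) \<le> \<bar>xhat $ i\<bar>"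
  proof (cases "supp xhat = {i}")
    case True
    then show ?thesis
      using singleton_support_bound[OF feas _ gain] by (simp add: min.coboundedI2)
  next
    case False
    then obtain j where j: "j \<in> supp xhat" "i \<noteq> j" using i by auto
    obtain y where y: "y \<in> feasible D r \<gamma> b" "supp y \<subseteq> supp xhat - {i}"
      and yx: "norm_D D (y - xhat) \<le> rho D r \<gamma> i * \<bar>xhat $ i\<bar>"
      using exchange[OF D gamma feas gain i j] .
    have "card (supp y) \<le> card (supp xhat - {i})" using y(2) by (intro card_mono) auto
    then have "card (supp y) + 1 \<le> card (supp xhat)"
      using i by (metis Suc_eq_plus1 Suc_le_mono card.remove finite)
    then have "\<beta> * real (card (supp y)) + \<beta> \<le> \<beta> * real (card (supp xhat))"
      using \<open>\<beta> > 0\<close> by (metis distrib_left less_imp_le mult.right_neutral mult_left_mono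
          of_nat_1 of_nat_add of_nat_mono)
    then have "(norm_D D xhat)\<^sup>2 + \<beta> \<le> (norm_D D y)\<^sup>2"
      using minimal[OF y(1)] by (simp add: norm_D_power2[OF D] objective_def l0_norm_def)
    also have "norm_D D y \<le> norm_D D xhat + rho D r \<gamma> i * \<bar>xhat $ i\<bar>"
      using norm_D_triangle[OF D, of xhat "y - xhat"] yx by simp
    then have "(norm_D D y)\<^sup>2 \<le> (norm_D D xhat + rho D r \<gamma> i * \<bar>xhat $ i\<bar>)\<^sup>2"
      by (intro power_mono norm_D_nonneg[OF D])
    finally have "sqrt (eta D r \<gamma> b + \<beta>) - sqrt (eta D r \<gamma> b) \<le> rho D r \<gamma> i * \<bar>xhat $ i\<bar>"
    proof (rule sqrt_add_diff_le[rotated 3])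
      show "(norm_D D xhat)\<^sup>2 \<le> eta D r \<gamma> b"
        unfolding norm_D_power2[OF D]
        using i by (intro minimizer_quadratic_le_eta[OF D gamma \<open>b > 0\<close> \<open>\<beta> > 0\<close> gain minimal]) auto
      show "0 \<le> rho D r \<gamma> i * \<bar>xhat $ i\<bar>"
        using rho_pos[OF D j(2), of r \<gamma>] by simp
    qed (rule norm_D_nonneg[OF D])
    then show ?thesis
      using rho_pos[OF D j(2), of r \<gamma>]
      by (intro min.coboundedI1) (simp add: divide_le_eq mult.commute)
  qed
qed

end
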